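(* Let $e$ be a well-scoped (i.e. closed, $\emptyset\vdash e\ \mathsf{ok}$) dynamic program of the gradually typed lambda calculus, i.e. a core expression all of whose function annotations are $\star$, and let $\hat e$ be the expression obtained from $e$ by replacing each annotation $\star$ by a fresh type metavariable (distinct for distinct occurrences). Then $e$ has a migration: there exist an expression $e'$, a type $T$ and a constraint $\phi$ such that $\cdot\vdash \hat e\Rightarrow e',T,\phi$ (with $\cdot$ the empty environment) and $\phi$ is satisfied by some model $\sigma$.
   Context: **Syntax.** Base types $B::=\mathsf{int}\mid\mathsf{bool}$. Types $S,T::=B\mid S\to T\mid\star\mid\alpha$, where $\star$ is the unknown type and $\alpha,\beta,\gamma,\dots$ range over type metavariables. Constants $c$ are integer literals $n$ and boolean literals $b$, with $\mathit{ty}(n)=\mathsf{int}$, $\mathit{ty}(b)=\mathsf{bool}$. Core expressions: $e::=x\mid c\mid \mathsf{fun}(x:T).e\mid e_1\,e_2\mid e_1\times e_2$. Output expressions may also contain suspended coercion applications $[\mathsf{coerce}(T_1,T_2)]e$, where $T_1,T_2$ may contain metavariables. Environments $\Gamma$ are finite lists of bindings $x:T$. **Well-scopedness** $V\vdash e\ \mathsf{ok}$, for a set $V$ of variables: every free variable of $e$ lies in $V$ (inductively: $V\vdash x\ \mathsf{ok}$ if $x\in V$; $V\vdash c\ \mathsf{ok}$ always; $V\vdash\mathsf{fun}(x:S).e\ \mathsf{ok}$ if $V\cup\{x\}\vdash e\ \mathsf{ok}$; $V\vdash e_1\,e_2\ \mathsf{ok}$ and $V\vdash e_1\times e_2\ \mathsf{ok}$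 if $V\vdash e_1\ \mathsf{ok}$ and $V\vdash e_2\ \mathsf{ok}$). **Constraints.** $\phi::=T_1=T_2\mid w\mid\phi_1\wedge\phi_2\mid\phi_1\vee\phi_2\mid\neg\phi$, with $w$ ranging over boolean (weight) variables. A model $\sigma$ of $\phi$ assigns a metavariable-free type to every type metavariable and a boolean to every weight variable so that $\phi$ holds; equality of types is structural equality after substitution (types form an algebraic datatype). Define $\mathsf{ground}(T):=(T=\mathsf{int}\vee T=\mathsf{bool}\vee T=\star\to\star)$. **Constraint generation** $\Gamma\vdash e\Rightarrow e',T,\phi$ is defined by the following rules (fresh names do not occur elsewhere in the derivation, in $\Gamma$, or in the input expression): - (Id) If $x$ is bound in $\Gamma$ and $\alpha,w$ are fresh, then $\Gamma\vdash x\Rightarrow[\mathsf{coerce}(\Gamma(x),\alpha)]x,\ \alpha,\ (\alpha=\Gamma(x)\wedge w)\vee(\alpha=\star\wedge\neg w)$. - (Const) If $\alpha,w$ are fresh, then $\Gamma\vdash c\Rightarrow[\mathsf{coerce}(\mathit{ty}(c),\alpha)]c,\ \alpha,\ (\alpha=\mathit{ty}(c)\wedge w)\vee(\alpha=\star\wedge\neg w)$. - (Fun) If $\Gamma,x:\alpha\vdash e\Rightarrow e',T,\phi_1$, $\beta,w$ are fresh, and $\phi_2=(\beta=\alpha\to T\wedge w)\vee(\beta=\star\wedge\mathsf{ground}(\alpha\to T)\wedge\neg w)$, then $\Gamma\vdash\mathsf{fun}(x:\alpha).e\Rightarrow[\mathsf{coerce}(\alpha\to T,\beta)]\mathsf{fun}(x:\alpha).e',\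 \beta,\ \phi_1\wedge\phi_2$. - (App) If $\Gamma\vdash e_i\Rightarrow e_i',T_i,\phi_i$ for $i=1,2$, $\alpha,\beta,\gamma,w_1,w_2$ are fresh, $\phi_3=(T_1=\alpha\to\beta\wedge w_1)\vee(T_1=\star\wedge\alpha=\star\wedge\beta=\star\wedge\neg w_1)$, $\phi_4=(T_2=\alpha)$, $\phi_5=(\beta=\gamma\wedge w_2)\vee(\gamma=\star\wedge\neg w_2)$, then $\Gamma\vdash e_1\,e_2\Rightarrow[\mathsf{coerce}(\beta,\gamma)](([\mathsf{coerce}(T_1,\alpha\to\beta)]e_1')\,e_2'),\ \gamma,\ \phi_1\wedge\dots\wedge\phi_5$. - (Mul) If $\Gamma\vdash e_i\Rightarrow e_i',T_i,\phi_i$ for $i=1,2$, $\alpha,w_1,w_2,w_3$ are fresh, $\phi_3=(T_1=\mathsf{int}\wedge w_1)\vee(T_1=\star\wedge\neg w_1)$, $\phi_4=(T_2=\mathsf{int}\wedge w_2)\vee(T_2=\star\wedge\neg w_2)$, $\phi_5=(\alpha=\mathsf{int}\wedge w_3)\vee(\alpha=\star\wedge\neg w_3)$, then $\Gamma\vdash e_1\times e_2\Rightarrow[\mathsf{coerce}(\mathsf{int},\alpha)]([\mathsf{coerce}(T_1,\mathsf{int})]e_1'\times[\mathsf{coerce}(T_2,\mathsf{int})]e_2'),\ \alpha,\ \phi_1\wedge\dots\wedge\phi_5$. *)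

theory Defs
  imports Main
begin

type_synonym vname = string
type_synonym tvar = nat
type_synonym wvar = nat

datatype ty = TInt | TBool | TFun ty ty | TStar | TVar tvar

datatype const = CInt int | CBool bool

datatype exp =
    Var vname
  | Const const
  | Fun vname ty exp
  | App exp exp
  | Mul exp exp

text \<open>Output expressions; \<open>OCoerce S T e\<close> is the suspended coercion application
  \<open>[coerce(S, T)] e\<close>.\<close>

datatype oexp =
    OVar vname
  | OConst const
  | OFun vname ty oexp
  | OApp oexp oexp
  | OMul oexp oexp
  | OCoerce ty ty oexp

datatype constr =
    Eq ty ty
  | Wt wvar
  | And constr constr  (infixr \<open>AND\<close> 35)
  | Or constr constr  (infixr \<open>OR\<close> 30)
  | Not constr

text \<open>Environments have the most recent binding first, so that \<open>map_of\<close> implements lookup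
  with shadowing.\<close>

type_synonym env = "(vname \<times> ty) list"

primrec const_ty :: "const \<Rightarrow> ty" where
  "const_ty (CInt n) = TInt"
| "const_ty (CBool b) = TBool"

primrec tvars :: "ty \<Rightarrow> tvar set" where
  "tvars TInt = {}"
| "tvars TBool = {}"
| "tvars (TFun S T) = tvars S \<union> tvars T"
| "tvars TStar = {}"
| "tvars (TVar a) = {a}"

primrec tvars_exp :: "exp \<Rightarrow> tvar set" where
  "tvars_exp (Var x) = {}"
| "tvars_exp (Const c) = {}"
| "tvars_exp (Fun x T e) = tvars T \<union> tvars_exp e"
| "tvars_exp (App e1 e2) = tvars_exp e1 \<union> tvars_exp e2"
| "tvars_exp (Mul e1 e2) = tvars_exp e1 \<union> tvars_exp e2"

definition tvars_env :: "env \<Rightarrow> tvar set" where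
  "tvars_env \<Gamma> = (\<Union>(x, T) \<in> set \<Gamma>. tvars T)"

inductive wscoped :: "vname set \<Rightarrow> exp \<Rightarrow> bool" where
  "x \<in> V \<Longrightarrow> wscoped V (Var x)"
| "wscoped V (Const c)"
| "wscoped (V \<union> {x}) e \<Longrightarrow> wscoped V (Fun x S e)"
| "wscoped V e1 \<Longrightarrow> wscoped V e2 \<Longrightarrow> wscoped V (App e1 e2)"
| "wscoped V e1 \<Longrightarrow> wscoped V e2 \<Longrightarrow> wscoped V (Mul e1 e2)"

primrec dynamic :: "exp \<Rightarrow> bool" where
  "dynamic (Var x) \<longleftrightarrow> True"
| "dynamic (Const c) \<longleftrightarrow> True"
| "dynamic (Fun x T e) \<longleftrightarrow> T = TStar \<and> dynamic e"
| "dynamic (App e1 e2) \<longleftrightarrow> dynamic e1 \<and> dynamic e2"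
| "dynamic (Mul e1 e2) \<longleftrightarrow> dynamic e1 \<and> dynamic e2"

text \<open>\<open>freshen e e' A\<close>: the expression \<open>e'\<close> arises from the dynamic expression \<open>e\<close> by replacing
  each annotation \<open>\<star>\<close> by a metavariable, with distinct metavariables for distinct occurrences;
  \<open>A\<close> is the set of metavariables introduced. As \<open>e\<close> contains no metavariables itself,
  distinctness is all that freshness demands.\<close>

inductive freshen :: "exp \<Rightarrow> exp \<Rightarrow> tvar set \<Rightarrow> bool" where
  "freshen (Var x) (Var x) {}"
| "freshen (Const c) (Const c) {}"
| "freshen e e' A \<Longrightarrow> a \<notin> A \<Longrightarrow> freshen (Fun x TStar e) (Fun x (TVar a) e') (insert a A)"
| "freshen e1 e1' A1 \<Longrightarrow> freshen e2 e2' A2 \<Longrightarrow> A1 \<inter> A2 = {} \<Longrightarrow>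
    freshen (App e1 e2) (App e1' e2') (A1 \<union> A2)"
| "freshen e1 e1' A1 \<Longrightarrow> freshen e2 e2' A2 \<Longrightarrow> A1 \<inter> A2 = {} \<Longrightarrow>
    freshen (Mul e1 e2) (Mul e1' e2') (A1 \<union> A2)"

type_synonym assignment = "(tvar \<Rightarrow> ty) \<times> (wvar \<Rightarrow> bool)"

primrec subst :: "(tvar \<Rightarrow> ty) \<Rightarrow> ty \<Rightarrow> ty" where
  "subst s TInt = TInt"
| "subst s TBool = TBool"
| "subst s (TFun S T) = TFun (subst s S) (subst s T)"
| "subst s TStar = TStar"
| "subst s (TVar a) = s a"

primrec holds :: "assignment \<Rightarrow> constr \<Rightarrow> bool" where
  "holds \<sigma> (Eq S T) \<longleftrightarrow> subst (fst \<sigma>) S = subst (fst \<sigma>) T"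
| "holds \<sigma> (Wt w) \<longleftrightarrow> snd \<sigma> w"
| "holds \<sigma> (And \<phi> \<psi>) \<longleftrightarrow> holds \<sigma> \<phi> \<and> holds \<sigma> \<psi>"
| "holds \<sigma> (Or \<phi> \<psi>) \<longleftrightarrow> holds \<sigma> \<phi> \<or> holds \<sigma> \<psi>"
| "holds \<sigma> (Not \<phi>) \<longleftrightarrow> \<not> holds \<sigma> \<phi>"

definition is_model :: "assignment \<Rightarrow> constr \<Rightarrow> bool" where
  "is_model \<sigma> \<phi> \<longleftrightarrow> (\<forall>a. tvars (fst \<sigma> a) = {}) \<and> holds \<sigma> \<phi>"

definition ground :: "ty \<Rightarrow> constr" where
  "ground T = (Eq T TInt OR Eq T TBool OR Eq T (TFun TStar TStar))"

text \<open>Constraint generation. The last two arguments, \<open>A\<close> and \<open>W\<close>, are the type metavariables and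
  the weight variables introduced by the derivation; they serve only to express freshness.
  A name is fresh if it occurs neither in the environment, nor in the input expression, nor
  anywhere else in the derivation. For two premises this also means that the names introduced
  in one of them are disjoint from those introduced in, or occurring in the input of, the other.\<close>

inductive cgen_using ::
  "env \<Rightarrow> exp \<Rightarrow> oexp \<Rightarrow> ty \<Rightarrow> constr \<Rightarrow> tvar set \<Rightarrow> wvar set \<Rightarrow> bool" where
  Id:
  "map_of \<Gamma> x = Some S \<Longrightarrow> \<alpha> \<notin> tvars_env \<Gamma> \<Longrightarrow>
   cgen_using \<Gamma> (Var x)
     (OCoerce S (TVar \<alpha>) (OVar x))
     (TVar \<alpha>)
     ((Eq (TVar \<alpha>) S AND Wt w) OR (Eq (TVar \<alpha>) TStar AND Not (Wt w)))
     {\<alpha>} {w}"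
| Const:
  "\<alpha> \<notin> tvars_env \<Gamma> \<Longrightarrow>
   cgen_using \<Gamma> (Const c)
     (OCoerce (const_ty c) (TVar \<alpha>) (OConst c))
     (TVar \<alpha>)
     ((Eq (TVar \<alpha>) (const_ty c) AND Wt w) OR (Eq (TVar \<alpha>) TStar AND Not (Wt w)))
     {\<alpha>} {w}"
| Fun:
  "cgen_using ((x, TVar \<alpha>) # \<Gamma>) e e' T \<phi>1 A W \<Longrightarrow>
   \<beta> \<notin> A \<union> tvars_env \<Gamma> \<union> tvars_exp (Fun x (TVar \<alpha>) e) \<Longrightarrow>
   w \<notin> W \<Longrightarrow>
   \<phi>2 = ((Eq (TVar \<beta>) (TFun (TVar \<alpha>) T) AND Wt w) OR
         (Eq (TVar \<beta>) TStar AND ground (TFun (TVar \<alpha>) T) AND Not (Wt w))) \<Longrightarrow>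
   cgen_using \<Gamma> (Fun x (TVar \<alpha>) e)
     (OCoerce (TFun (TVar \<alpha>) T) (TVar \<beta>) (OFun x (TVar \<alpha>) e'))
     (TVar \<beta>)
     (\<phi>1 AND \<phi>2)
     (insert \<beta> A) (insert w W)"
| App:
  "cgen_using \<Gamma> e1 e1' T1 \<phi>1 A1 W1 \<Longrightarrow>
   cgen_using \<Gamma> e2 e2' T2 \<phi>2 A2 W2 \<Longrightarrow>
   A1 \<inter> (A2 \<union> tvars_exp e2) = {} \<Longrightarrow> A2 \<inter> tvars_exp e1 = {} \<Longrightarrow> W1 \<inter> W2 = {} \<Longrightarrow>
   distinct [\<alpha>, \<beta>, \<gamma>] \<Longrightarrow>
   {\<alpha>, \<beta>, \<gamma>} \<inter> (A1 \<union> A2 \<union> tvars_env \<Gamma> \<union> tvars_exp (App e1 e2)) = {} \<Longrightarrow>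
   distinct [w1, w2] \<Longrightarrow> {w1, w2} \<inter> (W1 \<union> W2) = {} \<Longrightarrow>
   \<phi>3 = ((Eq T1 (TFun (TVar \<alpha>) (TVar \<beta>)) AND Wt w1) OR
         (Eq T1 TStar AND Eq (TVar \<alpha>) TStar AND Eq (TVar \<beta>) TStar AND Not (Wt w1))) \<Longrightarrow>
   \<phi>4 = Eq T2 (TVar \<alpha>) \<Longrightarrow>
   \<phi>5 = ((Eq (TVar \<beta>) (TVar \<gamma>) AND Wt w2) OR (Eq (TVar \<gamma>) TStar AND Not (Wt w2))) \<Longrightarrow>
   cgen_using \<Gamma> (App e1 e2)
     (OCoerce (TVar \<beta>) (TVar \<gamma>) (OApp (OCoerce T1 (TFun (TVar \<alpha>) (TVar \<beta>)) e1') e2'))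
     (TVar \<gamma>)
     (\<phi>1 AND \<phi>2 AND \<phi>3 AND \<phi>4 AND \<phi>5)
     (A1 \<union> A2 \<union> {\<alpha>, \<beta>, \<gamma>}) (W1 \<union> W2 \<union> {w1, w2})"
| Mul:
  "cgen_using \<Gamma> e1 e1' T1 \<phi>1 A1 W1 \<Longrightarrow>
   cgen_using \<Gamma> e2 e2' T2 \<phi>2 A2 W2 \<Longrightarrow>
   A1 \<inter> (A2 \<union> tvars_exp e2) = {} \<Longrightarrow> A2 \<inter> tvars_exp e1 = {} \<Longrightarrow> W1 \<inter> W2 = {} \<Longrightarrow>
   \<alpha> \<notin> A1 \<union> A2 \<union> tvars_env \<Gamma> \<union> tvars_exp (Mul e1 e2) \<Longrightarrow>
   distinct [w1, w2, w3] \<Longrightarrow> {w1, w2, w3} \<inter> (W1 \<union> W2) = {} \<Longrightarrow>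
   \<phi>3 = ((Eq T1 TInt AND Wt w1) OR (Eq T1 TStar AND Not (Wt w1))) \<Longrightarrow>
   \<phi>4 = ((Eq T2 TInt AND Wt w2) OR (Eq T2 TStar AND Not (Wt w2))) \<Longrightarrow>
   \<phi>5 = ((Eq (TVar \<alpha>) TInt AND Wt w3) OR (Eq (TVar \<alpha>) TStar AND Not (Wt w3))) \<Longrightarrow>
   cgen_using \<Gamma> (Mul e1 e2)
     (OCoerce TInt (TVar \<alpha>) (OMul (OCoerce T1 TInt e1') (OCoerce T2 TInt e2')))
     (TVar \<alpha>)
     (\<phi>1 AND \<phi>2 AND \<phi>3 AND \<phi>4 AND \<phi>5)
     (insert \<alpha> (A1 \<union> A2)) (W1 \<union> W2 \<union> {w1, w2, w3})"

definition cgen :: "env \<Rightarrow> exp \<Rightarrow> oexp \<Rightarrow> ty \<Rightarrow> constr \<Rightarrow> bool" where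
  "cgen \<Gamma> e e' T \<phi> \<longleftrightarrow> (\<exists>A W. cgen_using \<Gamma> e e' T \<phi> A W)"

end

theory Submission
  imports Defs
begin

text \<open>Constraint generation only fails on unbound variables, so it succeeds on the well-scoped
  expression \<open>e_hat\<close>. The constraint is satisfied by sending every metavariable to \<open>\<star>\<close> and every
  weight to false: each expression then has type \<open>\<star>\<close>, and the only side condition, groundness
  of the type of a function, holds because that type is \<open>\<star> \<rightarrow> \<star>\<close>.\<close>

text \<open>Both conjuncts go through one induction: the constraint of a function, application or
  product mentions the types of its subexpressions, and its unweighted disjunct (for a function,
  through groundness) or the equation \<open>Eq T2 (TVar \<alpha>)\<close> holds because these types
  become \<open>TStar\<close>.\<close>

lemma holds_all_star:
  "cgen_using \<Gamma> e e' T \<phi> A W \<Longrightarrow>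
    subst (\<lambda>_. TStar) T = TStar \<and> holds (\<lambda>_. TStar, \<lambda>_. False) \<phi>"
  by (induction rule: cgen_using.induct) (auto simp: ground_def)

text \<open>Finiteness lets the names of a finished derivation join the set that later choices
  avoid.\<close>

lemma finite_cgen_using:
  "cgen_using \<Gamma> e e' T \<phi> A W \<Longrightarrow> finite A \<and> finite W"
  by (induction rule: cgen_using.induct) auto

lemma finite_tvars: "finite (tvars T)"
  by (induction T) auto

lemma finite_tvars_exp: "finite (tvars_exp e)"
  by (induction e) (auto simp: finite_tvars)

lemma finite_tvars_env: "finite (tvars_env \<Gamma>)"
  by (auto simp: tvars_env_def finite_tvars)

lemma obtain_three_fresh:
  assumes "finite (F :: nat set)"
  obtains a b c where "distinct [a, b, c]" "{a, b, c} \<inter> F = {}"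
proof -
  obtain a where a: "a \<notin> F"
    using assms ex_new_if_finite infinite_UNIV_nat by blast
  obtain b where b: "b \<notin> insert a F"
    using assms ex_new_if_finite infinite_UNIV_nat by (metis finite_insert)
  obtain c where c: "c \<notin> insert a (insert b F)"
    using assms ex_new_if_finite infinite_UNIV_nat by (metis finite_insert)
  show thesis
    by (rule that[of a b c]) (use a b c in auto)
qed

text \<open>The sets \<open>N\<close> and \<open>M\<close> of names to avoid let the names of two sibling derivations be chosen
  apart.\<close>

lemma cgen_using_avoiding:
  assumes "freshen e e_hat B" "wscoped V e" "V \<subseteq> dom (map_of \<Gamma>)" "finite N" "finite M"
  shows "\<exists>e' T \<phi> A W. cgen_using \<Gamma> e_hat e' T \<phi> A W \<and> A \<inter> N = {} \<and> W \<inter> M = {}"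
  using assms
\<comment> \<open>A binder extends \<open>V\<close> and \<open>\<Gamma>\<close>; the second of two
  siblings must avoid more names than the first, so \<open>N\<close> and \<open>M\<close>
  grow.\<close>
proof (induction arbitrary: V \<Gamma> N M rule: freshen.induct)
  case (1 x)
  \<comment> \<open>Scoping pays off here: \<open>x\<close> lies in \<open>V\<close>, hence lookup
    in \<open>\<Gamma>\<close> succeeds.\<close>
  obtain S where S: "map_of \<Gamma> x = Some S"
    using 1 by (auto elim: wscoped.cases)
  obtain a where a: "a \<notin> N \<union> tvars_env \<Gamma>"
    using ex_new_if_finite[OF infinite_UNIV_nat] 1 finite_tvars_env by (metis finite_Un)
  obtain w where w: "w \<notin> M"
    using ex_new_if_finite[OF infinite_UNIV_nat] 1 by blast
  show ?case
    using cgen_using.Id[OF S, of a w] a w by blast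
next
  case (2 c)
  obtain a where a: "a \<notin> N \<union> tvars_env \<Gamma>"
    using ex_new_if_finite[OF infinite_UNIV_nat] 2 finite_tvars_env by (metis finite_Un)
  obtain w where w: "w \<notin> M"
    using ex_new_if_finite[OF infinite_UNIV_nat] 2 by blast
  show ?case
    using cgen_using.Const[of a \<Gamma> c w] a w by blast
next
  case (3 e e_hat B a x)
  have "wscoped (V \<union> {x}) e"
    using "3.prems"(1) by (auto elim: wscoped.cases)
  moreover have "V \<union> {x} \<subseteq> dom (map_of ((x, TVar a) # \<Gamma>))"
    using "3.prems"(2) by auto
  ultimately obtain e' T \<phi> A W
    where IH: "cgen_using ((x, TVar a) # \<Gamma>) e_hat e' T \<phi> A W" "A \<inter> N = {}" "W \<inter> M = {}"
    using "3.IH" "3.prems"(3,4) by meson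
  have fin: "finite A" "finite W"
    using finite_cgen_using[OF IH(1)] by auto
  \<comment> \<open>Besides what the rule demands, \<open>b\<close> avoids \<open>N\<close>, so that
    the enlarged set of introduced names stays clear of it.\<close>
  obtain b where b: "b \<notin> N \<union> (A \<union> tvars_env \<Gamma> \<union> tvars_exp (Fun x (TVar a) e_hat))"
    using ex_new_if_finite[OF infinite_UNIV_nat] "3.prems"(3) fin finite_tvars_env finite_tvars_exp
    by (metis finite_Un)
  obtain w where w: "w \<notin> M \<union> W"
    using ex_new_if_finite[OF infinite_UNIV_nat] "3.prems"(4) fin by (metis finite_Un)
  have "insert b A \<inter> N = {}" "insert w W \<inter> M = {}"
    using IH b w by auto
  then show ?case
    using cgen_using.Fun[OF IH(1) _ _ refl, of b w] b w by blast
next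
  case (4 e1 e1_hat B1 e2 e2_hat B2)
  have "wscoped V e1" "wscoped V e2"
    using "4.prems"(1) by (auto elim: wscoped.cases)
  note IH1 = "4.IH"(1)[OF this(1) "4.prems"(2)] and IH2 = "4.IH"(2)[OF this(2) "4.prems"(2)]
  \<comment> \<open>The left derivation comes first and avoids the annotations of the right operand;
    the right one then avoids \<open>A1\<close>, \<open>W1\<close> and the annotations of the left
    operand. This yields the disjointness that the rule asks of its premises.\<close>
  obtain e1' T1 \<phi>1 A1 W1 where d1: "cgen_using \<Gamma> e1_hat e1' T1 \<phi>1 A1 W1"
    and av1: "A1 \<inter> (N \<union> tvars_exp e2_hat) = {}" "W1 \<inter> M = {}"
    using IH1[of "N \<union> tvars_exp e2_hat" M] "4.prems"(3,4) finite_tvars_exp by auto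
  have fin1: "finite A1" "finite W1"
    using finite_cgen_using[OF d1] by auto
  obtain e2' T2 \<phi>2 A2 W2 where d2: "cgen_using \<Gamma> e2_hat e2' T2 \<phi>2 A2 W2"
    and av2: "A2 \<inter> (N \<union> A1 \<union> tvars_exp e1_hat) = {}" "W2 \<inter> (M \<union> W1) = {}"
    using IH2[of "N \<union> A1 \<union> tvars_exp e1_hat" "M \<union> W1"] "4.prems"(3,4) fin1 finite_tvars_exp
    by auto
  have fin2: "finite A2" "finite W2"
    using finite_cgen_using[OF d2] by auto
  obtain a b c where abc: "distinct [a, b, c]"
    "{a, b, c} \<inter> (N \<union> (A1 \<union> A2 \<union> tvars_env \<Gamma> \<union> tvars_exp (App e1_hat e2_hat))) = {}"
    using obtain_three_fresh "4.prems"(3) fin1 fin2 finite_tvars_env finite_tvars_exp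
    by (metis finite_Un)
  \<comment> \<open>The rule for applications takes the two weights \<open>u\<close> and
    \<open>v\<close> from this triple.\<close>
  obtain u v w where uvw: "distinct [u, v, w]" "{u, v, w} \<inter> (M \<union> (W1 \<union> W2)) = {}"
    using obtain_three_fresh "4.prems"(4) fin1 fin2 by (metis finite_Un)
  have "A1 \<inter> (A2 \<union> tvars_exp e2_hat) = {}" "A2 \<inter> tvars_exp e1_hat = {}" "W1 \<inter> W2 = {}"
    "{a, b, c} \<inter> (A1 \<union> A2 \<union> tvars_env \<Gamma> \<union> tvars_exp (App e1_hat e2_hat)) = {}"
    "distinct [u, v]" "{u, v} \<inter> (W1 \<union> W2) = {}"
    using av1 av2 abc uvw by auto
  note cgen_using.App[OF d1 d2 this(1-3) abc(1) this(4-6) refl refl refl]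
  moreover have "(A1 \<union> A2 \<union> {a, b, c}) \<inter> N = {}" "(W1 \<union> W2 \<union> {u, v}) \<inter> M = {}"
    using av1 av2 abc uvw by auto
  ultimately show ?case
    by blast
next
  case (5 e1 e1_hat B1 e2 e2_hat B2)
  have "wscoped V e1" "wscoped V e2"
    using "5.prems"(1) by (auto elim: wscoped.cases)
  note IH1 = "5.IH"(1)[OF this(1) "5.prems"(2)] and IH2 = "5.IH"(2)[OF this(2) "5.prems"(2)]
  obtain e1' T1 \<phi>1 A1 W1 where d1: "cgen_using \<Gamma> e1_hat e1' T1 \<phi>1 A1 W1"
    and av1: "A1 \<inter> (N \<union> tvars_exp e2_hat) = {}" "W1 \<inter> M = {}"
    using IH1[of "N \<union> tvars_exp e2_hat" M] "5.prems"(3,4) finite_tvars_exp by auto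
  have fin1: "finite A1" "finite W1"
    using finite_cgen_using[OF d1] by auto
  obtain e2' T2 \<phi>2 A2 W2 where d2: "cgen_using \<Gamma> e2_hat e2' T2 \<phi>2 A2 W2"
    and av2: "A2 \<inter> (N \<union> A1 \<union> tvars_exp e1_hat) = {}" "W2 \<inter> (M \<union> W1) = {}"
    using IH2[of "N \<union> A1 \<union> tvars_exp e1_hat" "M \<union> W1"] "5.prems"(3,4) fin1 finite_tvars_exp
    by auto
  have fin2: "finite A2" "finite W2"
    using finite_cgen_using[OF d2] by auto
  \<comment> \<open>A product has one new metavariable, for its result, but three weights: one per
    operand and one for the result.\<close>
  obtain a where a: "a \<notin> N \<union> (A1 \<union> A2 \<union> tvars_env \<Gamma> \<union> tvars_exp (Mul e1_hat e2_hat))"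
    using ex_new_if_finite[OF infinite_UNIV_nat] "5.prems"(3) fin1 fin2
      finite_tvars_env finite_tvars_exp
    by (metis finite_Un)
  obtain u v w where uvw: "distinct [u, v, w]" "{u, v, w} \<inter> (M \<union> (W1 \<union> W2)) = {}"
    using obtain_three_fresh "5.prems"(4) fin1 fin2 by (metis finite_Un)
  have "A1 \<inter> (A2 \<union> tvars_exp e2_hat) = {}" "A2 \<inter> tvars_exp e1_hat = {}" "W1 \<inter> W2 = {}"
    "a \<notin> A1 \<union> A2 \<union> tvars_env \<Gamma> \<union> tvars_exp (Mul e1_hat e2_hat)"
    "{u, v, w} \<inter> (W1 \<union> W2) = {}"
    using av1 av2 a uvw by auto
  note cgen_using.Mul[OF d1 d2 this(1-4) uvw(1) this(5) refl refl refl]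
  moreover have "insert a (A1 \<union> A2) \<inter> N = {}" "(W1 \<union> W2 \<union> {u, v, w}) \<inter> M = {}"
    using av1 av2 a uvw by auto
  ultimately show ?case
    by blast
qed

theorem theorem4p2:
  fixes e e_hat :: exp and A :: "tvar set"
  assumes "wscoped {} e"
    and "dynamic e"
    and "freshen e e_hat A"
  shows "\<exists>e' T \<phi>. cgen [] e_hat e' T \<phi> \<and> (\<exists>\<sigma>. is_model \<sigma> \<phi>)"
proof -
  \<comment> \<open>At the top level nothing has to be avoided, and the empty environment covers the
    empty scope.\<close>
  obtain e' T \<phi> B W where d: "cgen_using [] e_hat e' T \<phi> B W"
    using cgen_using_avoiding[OF assms(3,1), of "[]" "{}" "{}"] by auto
  \<comment> \<open>The constant assignment has metavariable-free values because
    \<open>tvars TStar\<close> is empty.\<close>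
  then have "is_model (\<lambda>_. TStar, \<lambda>_. False) \<phi>"
    using holds_all_star by (simp add: is_model_def)
  with d show ?thesis
    unfolding cgen_def by blast
qed

end
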